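(* Let $\alpha=1/3$, let $c_1,c_2,k>0$ be real with $c_1\neq c_2$, and let $k_1=k_2=k$. The unique equilibrium $(p_1,p_2)$ with $p_1>0$ and $p_2>0$ of the map $G$ (defined in the context) is locally stable if one of the following conditions is satisfied: 1. $R_3>0$ and $R_4>0$; 2. $R_3<0$, $R_4>0$, $A_1>0$, $A_2<0$ and $A_3>0$, where $R_3,R_4,A_1,A_2,A_3$ are the polynomials in $(c_1,c_2,k)$ given in the context.
   Context: For $\alpha=1/3$ the dynamic Bertrand duopoly game is the iteration $(p_1(t+1),p_2(t+1))=G(p_1(t),p_2(t))$ with $$G(p_1,p_2)=\left(p_1+k_1\frac{-p_1\sqrt{p_1p_2}+(2p_2+3\sqrt{p_1p_2})c_1}{2p_1^2(\sqrt{p_1}+\sqrt{p_2})^2},\;\; p_2+k_2\frac{-p_2\sqrt{p_1p_2}+(2p_1+3\sqrt{p_1p_2})c_2}{2p_2^2(\sqrt{p_1}+\sqrt{p_2})^2}\right),\qquad p_1,p_2>0,$$ where $c_i>0$ are marginal costs and $k_i>0$ are adjustment speeds. An equilibrium is a fixed point of $G$; $G$ has exactly one equilibrium with both coordinates positive. With $M$ the Jacobian matrix of $G$ at this equilibrium, the equilibrium is called locally stable when both eigenvalues of $M$ have modulus $<1$, equivalently (Jury criterion) when $1-\mathrm{Tr}(M)+\mathrm{Det}(M)>0$, $1+\mathrm{Tr}(M)+\mathrm{Det}(M)>0$ and $1-\mathrm{Det}(M)>0$. The polynomials are $$\begin{aligned}R_3={}&-209715200000c_1^{12}c_2^{8}+838860800000c_1^{11}c_2^{9}-1258291200000c_1^{10}c_2^{10}+838860800000c_1^{9}c_2^{11}-209715200000c_1^{8}c_2^{12}\\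 &+1160950579200c_1^{13}c_2^{5}k-5170397184000c_1^{12}c_2^{6}k+9284105011200c_1^{11}c_2^{7}k-9178054656000c_1^{10}c_2^{8}k\\ &+7806792499200c_1^{9}c_2^{9}k-9178054656000c_1^{8}c_2^{10}k+9284105011200c_1^{7}c_2^{11}k-5170397184000c_1^{6}c_2^{12}k+1160950579200c_1^{5}c_2^{13}k\\ &+626913312768c_1^{13}c_2^{3}k^{2}-1827529703424c_1^{12}c_2^{4}k^{2}+6377496477696c_1^{11}c_2^{5}k^{2}-24562717922304c_1^{10}c_2^{6}k^{2}\\ &+56911413825536c_1^{9}c_2^{7}k^{2}-74841436780544c_1^{8}c_2^{8}k^{2}+56911413825536c_1^{7}c_2^{9}k^{2}-24562717922304c_1^{6}c_2^{10}k^{2}\\ &+6377496477696c_1^{5}c_2^{11}k^{2}-1827529703424c_1^{4}c_2^{12}k^{2}+626913312768c_1^{3}c_2^{13}k^{2}\\ &-117546246144c_1^{12}c_2^{2}k^{3}+2268751389696c_1^{11}c_2^{3}k^{3}-8446241806848c_1^{10}c_2^{4}k^{3}+13848228389376c_1^{9}c_2^{5}k^{3}\\ &-12871123435008c_1^{8}c_2^{6}k^{3}+10570707526656c_1^{7}c_2^{7}k^{3}-12871123435008c_1^{6}c_2^{8}k^{3}+13848228389376c_1^{5}c_2^{9}k^{3}\\ &-8446241806848c_1^{4}c_2^{10}k^{3}+2268751389696c_1^{3}c_2^{11}k^{3}-117546246144c_1^{2}c_2^{12}k^{3}\\ &+7346640384c_1^{11}c_2k^{4}+23872802112c_1^{10}c_2^{2}k^{4}-79144786368c_1^{9}c_2^{3}k^{4}-389232360000c_1^{8}c_2^{4}k^{4}\\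 &+1762366805056c_1^{7}c_2^{5}k^{4}-2639431381760c_1^{6}c_2^{6}k^{4}+1762366805056c_1^{5}c_2^{7}k^{4}-389232360000c_1^{4}c_2^{8}k^{4}\\ &-79144786368c_1^{3}c_2^{9}k^{4}+23872802112c_1^{2}c_2^{10}k^{4}+7346640384c_1c_2^{11}k^{4}\\ &-153055008c_1^{10}k^{5}+444048480c_1^{9}c_2k^{5}-2281361760c_1^{8}c_2^{2}k^{5}-6359031360c_1^{7}c_2^{3}k^{5}\\ &+33853070112c_1^{6}c_2^{4}k^{5}-51945109632c_1^{5}c_2^{5}k^{5}+33853070112c_1^{4}c_2^{6}k^{5}-6359031360c_1^{3}c_2^{7}k^{5}\\ &-2281361760c_1^{2}c_2^{8}k^{5}+444048480c_1c_2^{9}k^{5}-153055008c_2^{10}k^{5}\\ &+36636624c_1^{7}c_2k^{6}-65578896c_1^{6}c_2^{2}k^{6}+239834412c_1^{5}c_2^{3}k^{6}-377249916c_1^{4}c_2^{4}k^{6}\\ &+239834412c_1^{3}c_2^{5}k^{6}-65578896c_1^{2}c_2^{6}k^{6}+36636624c_1c_2^{7}k^{6}\\ &-669222c_1^{5}c_2k^{7}+1023534c_1^{4}c_2^{2}k^{7}-951468c_1^{3}c_2^{3}k^{7}+1023534c_1^{2}c_2^{4}k^{7}-669222c_1c_2^{5}k^{7}\\ &+2187c_1^{3}c_2k^{8}-4031c_1^{2}c_2^{2}k^{8}+2187c_1c_2^{3}k^{8},\end{aligned}$$ $$\begin{aligned}R_4={}&17714700c_1^{10}c_2^{2}-84798900c_1^{9}c_2^{3}+166819500c_1^{8}c_2^{4}-187523100c_1^{7}c_2^{5}+175575600c_1^{6}c_2^{6}\\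 &-187523100c_1^{5}c_2^{7}+166819500c_1^{4}c_2^{8}-84798900c_1^{3}c_2^{9}+17714700c_1^{2}c_2^{10}\\ &+19131876c_1^{10}k-55506060c_1^{9}c_2k+70441812c_1^{8}c_2^{2}k-70683840c_1^{7}c_2^{3}k+106503012c_1^{6}c_2^{4}k\\ &-136123200c_1^{5}c_2^{5}k+106503012c_1^{4}c_2^{6}k-70683840c_1^{3}c_2^{7}k+70441812c_1^{2}c_2^{8}k-55506060c_1c_2^{9}k+19131876c_2^{10}k\\ &-9159156c_1^{7}c_2k^{2}+23480604c_1^{6}c_2^{2}k^{2}-24625107c_1^{5}c_2^{3}k^{2}+19286271c_1^{4}c_2^{4}k^{2}\\ &-24625107c_1^{3}c_2^{5}k^{2}+23480604c_1^{2}c_2^{6}k^{2}-9159156c_1c_2^{7}k^{2}\\ &+334611c_1^{5}c_2k^{3}-511767c_1^{4}c_2^{2}k^{3}+475734c_1^{3}c_2^{3}k^{3}-511767c_1^{2}c_2^{4}k^{3}+334611c_1c_2^{5}k^{3}\\ &-2187c_1^{3}c_2k^{4}+4031c_1^{2}c_2^{2}k^{4}-2187c_1c_2^{3}k^{4},\end{aligned}$$ $$A_1=243c_1^{2}+352c_1c_2-9k,$$ $$\begin{aligned}A_2={}&-8000c_1^{5}c_2^{3}+19683c_1^{6}k-17496c_1^{5}c_2k+3024c_1^{4}c_2^{2}k+1728c_1^{3}c_2^{3}k\\ &-2187c_1^{4}k^{2}+3564c_1^{3}c_2k^{2}-432c_1^{2}c_2^{2}k^{2}+81c_1^{2}k^{3}+36c_1c_2k^{3}-k^{4},\end{aligned}$$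 $$\begin{aligned}A_3={}&12754584c_1^{7}-12171384c_1^{6}c_2+3708504c_1^{5}c_2^{2}+84096c_1^{4}c_2^{3}+2519424c_1^{3}c_2^{4}\\ &-72171c_1^{5}k-3576744c_1^{4}c_2k+5126856c_1^{3}c_2^{2}k-629856c_1^{2}c_2^{3}k\\ &-25272c_1^{3}k^{2}+98966c_1^{2}c_2k^{2}+52488c_1c_2^{2}k^{2}+387c_1k^{3}-1458c_2k^{3}.\end{aligned}$$ *)

theory Defs
  imports "HOL-Analysis.Analysis"
begin

(* The map is only meaningful for positive prices; outside the open positive
   quadrant its values are artefacts of totalised division and square root. *)
definition G :: "real \<Rightarrow> real \<Rightarrow> real \<Rightarrow> real \<Rightarrow> real^2 \<Rightarrow> real^2" where
  "G c1 c2 k1 k2 p = vector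
    [p$1 + k1 * ((- p$1 * sqrt (p$1 * p$2) + (2 * p$2 + 3 * sqrt (p$1 * p$2)) * c1)
                 / (2 * (p$1)^2 * (sqrt (p$1) + sqrt (p$2))^2)),
     p$2 + k2 * ((- p$2 * sqrt (p$1 * p$2) + (2 * p$1 + 3 * sqrt (p$1 * p$2)) * c2)
                 / (2 * (p$2)^2 * (sqrt (p$1) + sqrt (p$2))^2))]"

definition positive_equilibrium :: "(real^2 \<Rightarrow> real^2) \<Rightarrow> real^2 \<Rightarrow> bool" where
  "positive_equilibrium f p \<longleftrightarrow> p$1 > 0 \<and> p$2 > 0 \<and> f p = p"

(* Eigenvalues of a real matrix are taken over the complex numbers. *)
definition complex_eigenvalue :: "real^'n^'n \<Rightarrow> complex \<Rightarrow> bool" where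
  "complex_eigenvalue M z \<longleftrightarrow>
    (\<exists>v :: complex^'n. v \<noteq> 0 \<and> (\<chi> i j. complex_of_real (M$i$j)) *v v = z *s v)"

(* Differentiability is demanded because "jacobian" is unspecified without it. *)
definition locally_stable :: "(real^'n \<Rightarrow> real^'n) \<Rightarrow> real^'n \<Rightarrow> bool" where
  "locally_stable f p \<longleftrightarrow>
    f differentiable (at p) \<and>
    (\<forall>z. complex_eigenvalue (jacobian f (at p)) z \<longrightarrow> cmod z < 1)"

definition R3 :: "real \<Rightarrow> real \<Rightarrow> real \<Rightarrow> real" where
  "R3 c1 c2 k =
    -209715200000 * c1^12 * c2^8 + 838860800000 * c1^11 * c2^9 - 1258291200000 * c1^10 * c2^10 + 838860800000 * c1^9 * c2^11 - 209715200000 * c1^8 * c2^12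
    + 1160950579200 * c1^13 * c2^5 * k - 5170397184000 * c1^12 * c2^6 * k + 9284105011200 * c1^11 * c2^7 * k - 9178054656000 * c1^10 * c2^8 * k
    + 7806792499200 * c1^9 * c2^9 * k - 9178054656000 * c1^8 * c2^10 * k + 9284105011200 * c1^7 * c2^11 * k - 5170397184000 * c1^6 * c2^12 * k + 1160950579200 * c1^5 * c2^13 * k
    + 626913312768 * c1^13 * c2^3 * k^2 - 1827529703424 * c1^12 * c2^4 * k^2 + 6377496477696 * c1^11 * c2^5 * k^2 - 24562717922304 * c1^10 * c2^6 * k^2
    + 56911413825536 * c1^9 * c2^7 * k^2 - 74841436780544 * c1^8 * c2^8 * k^2 + 56911413825536 * c1^7 * c2^9 * k^2 - 24562717922304 * c1^6 * c2^10 * k^2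
    + 6377496477696 * c1^5 * c2^11 * k^2 - 1827529703424 * c1^4 * c2^12 * k^2 + 626913312768 * c1^3 * c2^13 * k^2
    - 117546246144 * c1^12 * c2^2 * k^3 + 2268751389696 * c1^11 * c2^3 * k^3 - 8446241806848 * c1^10 * c2^4 * k^3 + 13848228389376 * c1^9 * c2^5 * k^3
    - 12871123435008 * c1^8 * c2^6 * k^3 + 10570707526656 * c1^7 * c2^7 * k^3 - 12871123435008 * c1^6 * c2^8 * k^3 + 13848228389376 * c1^5 * c2^9 * k^3
    - 8446241806848 * c1^4 * c2^10 * k^3 + 2268751389696 * c1^3 * c2^11 * k^3 - 117546246144 * c1^2 * c2^12 * k^3
    + 7346640384 * c1^11 * c2 * k^4 + 23872802112 * c1^10 * c2^2 * k^4 - 79144786368 * c1^9 * c2^3 * k^4 - 389232360000 * c1^8 * c2^4 * k^4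
    + 1762366805056 * c1^7 * c2^5 * k^4 - 2639431381760 * c1^6 * c2^6 * k^4 + 1762366805056 * c1^5 * c2^7 * k^4 - 389232360000 * c1^4 * c2^8 * k^4
    - 79144786368 * c1^3 * c2^9 * k^4 + 23872802112 * c1^2 * c2^10 * k^4 + 7346640384 * c1 * c2^11 * k^4
    - 153055008 * c1^10 * k^5 + 444048480 * c1^9 * c2 * k^5 - 2281361760 * c1^8 * c2^2 * k^5 - 6359031360 * c1^7 * c2^3 * k^5
    + 33853070112 * c1^6 * c2^4 * k^5 - 51945109632 * c1^5 * c2^5 * k^5 + 33853070112 * c1^4 * c2^6 * k^5 - 6359031360 * c1^3 * c2^7 * k^5
    - 2281361760 * c1^2 * c2^8 * k^5 + 444048480 * c1 * c2^9 * k^5 - 153055008 * c2^10 * k^5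
    + 36636624 * c1^7 * c2 * k^6 - 65578896 * c1^6 * c2^2 * k^6 + 239834412 * c1^5 * c2^3 * k^6 - 377249916 * c1^4 * c2^4 * k^6
    + 239834412 * c1^3 * c2^5 * k^6 - 65578896 * c1^2 * c2^6 * k^6 + 36636624 * c1 * c2^7 * k^6
    - 669222 * c1^5 * c2 * k^7 + 1023534 * c1^4 * c2^2 * k^7 - 951468 * c1^3 * c2^3 * k^7 + 1023534 * c1^2 * c2^4 * k^7 - 669222 * c1 * c2^5 * k^7
    + 2187 * c1^3 * c2 * k^8 - 4031 * c1^2 * c2^2 * k^8 + 2187 * c1 * c2^3 * k^8"

definition R4 :: "real \<Rightarrow> real \<Rightarrow> real \<Rightarrow> real" where
  "R4 c1 c2 k =
    17714700 * c1^10 * c2^2 - 84798900 * c1^9 * c2^3 + 166819500 * c1^8 * c2^4 - 187523100 * c1^7 * c2^5 + 175575600 * c1^6 * c2^6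
    - 187523100 * c1^5 * c2^7 + 166819500 * c1^4 * c2^8 - 84798900 * c1^3 * c2^9 + 17714700 * c1^2 * c2^10
    + 19131876 * c1^10 * k - 55506060 * c1^9 * c2 * k + 70441812 * c1^8 * c2^2 * k - 70683840 * c1^7 * c2^3 * k + 106503012 * c1^6 * c2^4 * k
    - 136123200 * c1^5 * c2^5 * k + 106503012 * c1^4 * c2^6 * k - 70683840 * c1^3 * c2^7 * k + 70441812 * c1^2 * c2^8 * k - 55506060 * c1 * c2^9 * k + 19131876 * c2^10 * k
    - 9159156 * c1^7 * c2 * k^2 + 23480604 * c1^6 * c2^2 * k^2 - 24625107 * c1^5 * c2^3 * k^2 + 19286271 * c1^4 * c2^4 * k^2
    - 24625107 * c1^3 * c2^5 * k^2 + 23480604 * c1^2 * c2^6 * k^2 - 9159156 * c1 * c2^7 * k^2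
    + 334611 * c1^5 * c2 * k^3 - 511767 * c1^4 * c2^2 * k^3 + 475734 * c1^3 * c2^3 * k^3 - 511767 * c1^2 * c2^4 * k^3 + 334611 * c1 * c2^5 * k^3
    - 2187 * c1^3 * c2 * k^4 + 4031 * c1^2 * c2^2 * k^4 - 2187 * c1 * c2^3 * k^4"

definition A1 :: "real \<Rightarrow> real \<Rightarrow> real \<Rightarrow> real" where
  "A1 c1 c2 k =
    243 * c1^2 + 352 * c1 * c2 - 9 * k"

definition A2 :: "real \<Rightarrow> real \<Rightarrow> real \<Rightarrow> real" where
  "A2 c1 c2 k =
    -8000 * c1^5 * c2^3 + 19683 * c1^6 * k - 17496 * c1^5 * c2 * k + 3024 * c1^4 * c2^2 * k + 1728 * c1^3 * c2^3 * k
    - 2187 * c1^4 * k^2 + 3564 * c1^3 * c2 * k^2 - 432 * c1^2 * c2^2 * k^2 + 81 * c1^2 * k^3 + 36 * c1 * c2 * k^3 - k^4"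

definition A3 :: "real \<Rightarrow> real \<Rightarrow> real \<Rightarrow> real" where
  "A3 c1 c2 k =
    12754584 * c1^7 - 12171384 * c1^6 * c2 + 3708504 * c1^5 * c2^2 + 84096 * c1^4 * c2^3 + 2519424 * c1^3 * c2^4
    - 72171 * c1^5 * k - 3576744 * c1^4 * c2 * k + 5126856 * c1^3 * c2^2 * k - 629856 * c1^2 * c2^3 * k
    - 25272 * c1^3 * k^2 + 98966 * c1^2 * c2 * k^2 + 52488 * c1 * c2^2 * k^2 + 387 * c1 * k^3 - 1458 * c2 * k^3"

end

theory Submission
  imports Defs "HOL-Computational_Algebra.Polynomial"
begin

text \<open>Let \<open>a, b\<close> be the square roots of the equilibrium prices. The equilibrium equations read
  \<open>a\<^sup>3 = (2b + 3a) c1\<close> and \<open>b\<^sup>3 = (2a + 3b) c2\<close>, so \<open>t = b / a\<close> is the only positive root of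
  \<open>t\<^sup>3 (2t + 3) c1 = (3t + 2) c2\<close>, and the Jacobian is rational in \<open>a, b, k\<close>. The first Jury inequality
  always holds; the other two are a quadratic and a linear condition in \<open>k\<close>, with coefficients
  polynomial in \<open>z = (b - a)\<^sup>2 / (a b) \<ge> 0\<close>. They are factors of \<open>R3\<close> and \<open>R4\<close>, whose cofactors are
  nonnegative as soon as the respective inequality fails: this settles the linear condition and the
  first case. If the quadratic inequality fails, then \<open>k\<close> is at least the zero of the quadratic with
  its leading term dropped; above that bound \<open>A1 > 0\<close> forces \<open>A2 \<ge> 0\<close> when \<open>c2 \<le> c1\<close>, and \<open>A3 \<le> 0\<close> when
  \<open>c1 < c2\<close>.\<close>

section \<open>Nonnegativity of polynomials\<close>

text \<open>A sufficient sign test: later inequalities are arranged as explicit polynomials in a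
  nonnegative variable, so each reduces to inspecting finitely many coefficients.\<close>

lemma poly_nonneg:
  fixes p :: "'a::linordered_idom poly"
  assumes "\<forall>c\<in>set (coeffs p). 0 \<le> c" and "0 \<le> x"
  shows "0 \<le> poly p x"
  using assms by (induction p) (auto simp: cCons_def split: if_splits)

text \<open>The hypotheses are the Taylor coefficients of the cubic at \<open>n / d\<close>, cleared of denominators.\<close>

lemma cubic_nonneg:
  fixes c0 c1 c2 c3 n d k :: "'a::linordered_idom"
  assumes d: "0 < d" and k: "n \<le> d * k"
    and c3: "0 \<le> c3" and t2: "0 \<le> c2 * d + 3 * c3 * n"
    and t1: "0 \<le> c1 * d^2 + 2 * c2 * n * d + 3 * c3 * n^2"
    and t0: "0 \<le> c0 * d^3 + c1 * n * d^2 + c2 * n^2 * d + c3 * n^3"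
  shows "0 \<le> c0 + c1 * k + c2 * k^2 + c3 * k^3"
proof -
  define h where "h = d * k - n"
  have h: "0 \<le> h" using k by (simp add: h_def)
  have "0 \<le> (c1 * d^2 + 2 * c2 * n * d + 3 * c3 * n^2) * h"
    and "0 \<le> (c2 * d + 3 * c3 * n) * h^2" and "0 \<le> c3 * h^3"
    using t1 t2 c3 h by simp_all
  with t0 have "0 \<le> (c0 * d^3 + c1 * n * d^2 + c2 * n^2 * d + c3 * n^3) +
      (c1 * d^2 + 2 * c2 * n * d + 3 * c3 * n^2) * h + (c2 * d + 3 * c3 * n) * h^2 + c3 * h^3"
    by linarith
  also have "\<dots> = d^3 * (c0 + c1 * k + c2 * k^2 + c3 * k^3)"
    unfolding h_def by algebra
  finally show ?thesis
    using d by (simp add: zero_le_mult_iff)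
qed

section \<open>The polynomials \<open>R3\<close> and \<open>R4\<close> along the equilibrium\<close>

text \<open>Both polynomials are symmetric in the costs; \<open>r3_j\<close> and \<open>r4_j\<close> are their coefficients of
  \<open>k^j\<close> as polynomials in \<open>x = c1 c2\<close> and \<open>y = (c1 - c2)\<^sup>2\<close>.\<close>

definition r3_0 :: "'a::comm_ring_1 \<Rightarrow> 'a \<Rightarrow> 'a" where
  "r3_0 x y = - 209715200000 * x^8 * y^2"

definition r3_1 :: "'a::comm_ring_1 \<Rightarrow> 'a \<Rightarrow> 'a" where
  "r3_1 x y = 1480733491200 * x^7 * y^2 + 4117207449600 * x^6 * y^3 + 1160950579200 * x^5 * y^4"

definition r3_2 :: "'a::comm_ring_1 \<Rightarrow> 'a \<Rightarrow> 'a" where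
  "r3_2 x y = 209715200000 * x^8 + 2490368000000 * x^7 * y + 8497332513792 * x^6 * y^2 +
  13699224797184 * x^5 * y^3 + 4441603424256 * x^4 * y^4 + 626913312768 * x^3 * y^5"

definition r3_3 :: "'a::comm_ring_1 \<Rightarrow> 'a \<Rightarrow> 'a" where
  "r3_3 x y = - 65155891200 * x^7 - 133020057600 * x^6 * y + 2668493035008 * x^5 * y^2 +
  5589650695680 * x^4 * y^3 + 1093288928256 * x^3 * y^4 - 117546246144 * x^2 * y^5"

definition r3_4 :: "'a::comm_ring_1 \<Rightarrow> 'a \<Rightarrow> 'a" where
  "r3_4 x y = 10986820608 * x^6 + 58765131136 * x^5 * y - 19313016768 * x^4 * y^2 + 368970043968 *
  x^3 * y^3 + 97339205952 * x^2 * y^4 + 7346640384 * x * y^5"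

definition r3_5 :: "'a::comm_ring_1 \<Rightarrow> 'a \<Rightarrow> 'a" where
  "r3_5 x y = - 937768704 * x^5 - 8836910688 * x^4 * y - 18818982720 * x^3 * y^2 - 4085899200 * x^2
  * y^3 - 1086501600 * x * y^4 - 153055008 * y^5"

definition r3_6 :: "'a::comm_ring_1 \<Rightarrow> 'a \<Rightarrow> 'a" where
  "r3_6 x y = 44534364 * x^4 + 307248444 * x^3 * y + 154240848 * x^2 * y^2 + 36636624 * x * y^3"

definition r3_7 :: "'a::comm_ring_1 \<Rightarrow> 'a \<Rightarrow> 'a" where
  "r3_7 x y = - 242844 * x^3 - 1653354 * x^2 * y - 669222 * x * y^2"

definition r3_8 :: "'a::comm_ring_1 \<Rightarrow> 'a \<Rightarrow> 'a" where
  "r3_8 x y = 343 * x^2 + 2187 * x * y"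

definition r4_0 :: "'a::comm_ring_1 \<Rightarrow> 'a \<Rightarrow> 'a" where
  "r4_0 x y = 12320100 * x^4 * y^2 + 56918700 * x^3 * y^3 + 17714700 * x^2 * y^4"

definition r4_1 :: "'a::comm_ring_1 \<Rightarrow> 'a \<Rightarrow> 'a" where
  "r4_1 x y = 3650400 * x^5 + 47943900 * x^4 * y + 198439632 * x^3 * y^2 + 296008992 * x^2 * y^3 +
  135812700 * x * y^4 + 19131876 * y^5"

definition r4_2 :: "'a::comm_ring_1 \<Rightarrow> 'a \<Rightarrow> 'a" where
  "r4_2 x y = - 1321047 * x^4 - 13135095 * x^3 * y - 31474332 * x^2 * y^2 - 9159156 * x * y^3"

definition r4_3 :: "'a::comm_ring_1 \<Rightarrow> 'a \<Rightarrow> 'a" where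
  "r4_3 x y = 121422 * x^3 + 826677 * x^2 * y + 334611 * x * y^2"

definition r4_4 :: "'a::comm_ring_1 \<Rightarrow> 'a \<Rightarrow> 'a" where
  "r4_4 x y = - 343 * x^2 - 2187 * x * y"

text \<open>\<open>r4c0\<close> to \<open>r4c3\<close> come from dividing \<open>R4\<close> by
  \<open>det_jury\<close> as polynomials in \<open>\<kappa>\<close>.\<close>

definition r4c0 :: "real poly" where
  "r4c0 = [:0, 0, 616261668750, 21965756100750, 55648702648350, 63781689157200, 42582171398400,
  18192861273600, 5155672420800, 969242284800, 116593344000, 8146137600, 251942400:]"

definition r4c1 :: "real poly" where
  "r4c1 = [:118828125, 12000403125, 380450405250, 4353338653920, 16326104728878, 30200259099978,
  33154512806538, 23690513095920, 11563167861504, 3941807369472, 940709858112, 154360629504,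
  16618120704, 1058158080, 30233088:]"

definition r4c2 :: "real poly" where
  "r4c2 = [:-1706250, -128909250, -2266282215, -3096924171, -1417442976, -63079236, 157340880,
  56053296, 7931520, 419904:]"

definition r4c3 :: "real poly" where
  "r4c3 = [:6125, 307545, 246258, 65772, 5832:]"

text \<open>Likewise the quotient of \<open>R3\<close> by \<open>trace_jury\<close>, of degree 8 - 2
  = 6 in \<open>\<kappa>\<close>.\<close>

definition r3c0 :: "real poly" where
  "r3c0 = [:0, 0, -491724800000000000, -916013056000000000, -730434109440000000,
  -323189682995200000, -85693615308800000, -13615969075200000, -1200409804800000, -45298483200000:]"

definition r3c1 :: "real poly" where
  "r3c1 = [:0, 0, 138758592000000000, 3252390758400000000, 13517700975206400000,
  25130035826294784000, 26915556536855347200, 18564451502515814400, 8716388467271270400,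
  2857641842442240000, 656736377123635200, 103989958410240000, 10829347002777600, 668707533619200,
  18575209267200:]"

definition r3c2 :: "real poly" where
  "r3c2 = [:12800000000000, 1194496000000000, 32866633195000000, 448092006176400000,
  1844416518182848000, 4423798278885995520, 6819657876062005248, 7082674805243916288,
  5143074177275338752, 2680336608546521088, 1017232381940908032, 282001001929408512,
  56568480501989376, 8001771890540544, 757497033916416, 43094485499904, 1114512556032:]"

definition r3c3 :: "real poly" where
  "r3c3 = [:-156000000000, -2251680000000, 407318851950000, 7152606396342000, 22216190969333520,
  24587274661796928, 4994777779220736, -14162423775072768, -16726497460213248, -9647504735477760,
  -3485544751779840, -838588688363520, -135041851994112, -14043309686784, -855233593344,
  -23219011584:]"

definition r3c4 :: "real poly" where
  "r3c4 = [:1035312500, 44100812500, -4847821000, 19114969847520, 69446547982008, 123448373177256,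
  133396622749224, 94864291356096, 46253653834752, 15766123170816, 3762758810880, 617442518016,
  66472482816, 4232632320, 120932352:]"

definition r3c5 :: "real poly" where
  "r3c5 = [:-3412500, -257818500, -4532564430, -6193848342, -2834885952, -126158472, 314681760,
  112106592, 15863040, 839808:]"

definition r3c6 :: "real poly" where
  "r3c6 = [:6125, 307545, 246258, 65772, 5832:]"

text \<open>With \<open>z = (b - a)\<^sup>2 / (a b)\<close> for the square roots \<open>a, b\<close> of the equilibrium prices, the costs
  satisfy \<open>c1 c2 = s X(z)\<close> and \<open>(c1 - c2)\<^sup>2 = s Y(z)\<close> with the same factor \<open>s\<close>.\<close>

definition X :: "real poly" where "X = [:25, 6:]"

definition Y :: "real poly" where "Y = [:0, 1:] * [:4, 1:] * [:7, 2:]^2"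

text \<open>Since \<open>z + 2 = a/b + b/a\<close>, symmetric ratios in \<open>a\<close> and
  \<open>b\<close> are polynomials in \<open>z\<close>: \<open>P\<close> arises in the trace and
  \<open>Q\<close> in the determinant of the identity minus the Jacobian, and \<open>V\<close> is
  \<open>(a + b)^2 / (a b)\<close>.\<close>

definition P :: "real poly" where "P = [:5, 11, 3:]"

definition Q :: "real poly" where "Q = [:35, 9:]"

definition V :: "real poly" where "V = [:4, 1:]"

text \<open>Up to positive factors, \<open>trace_jury\<close> is \<open>1 + Tr M + Det M\<close> and \<open>det_jury\<close> is \<open>1 - Det M\<close>,
  where \<open>k = s \<kappa>\<close>.\<close>

definition trace_jury :: "real \<Rightarrow> real \<Rightarrow> real" where
  "trace_jury z \<kappa> =
    poly (16 * V^2 * X^5) z - poly (12 * P * V^2 * X^2) z * \<kappa> + poly Q z * \<kappa>^2"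

definition det_jury :: "real \<Rightarrow> real \<Rightarrow> real" where
  "det_jury z \<kappa> = poly (6 * P * V^2 * X^2) z - poly Q z * \<kappa>"

text \<open>The equation \<open>t^3 (2t + 3) c1 = (3t + 2) c2\<close> for \<open>t = b / a\<close> has four complex roots, and \<open>R4\<close>
  and \<open>R3\<close> are the products of \<open>det_jury\<close> and \<open>trace_jury\<close> over these roots. The cofactors below
  collect the roots other than the equilibrium.\<close>

definition R4_cofactor :: "real \<Rightarrow> real \<Rightarrow> real" where
  "R4_cofactor z \<kappa> = poly r4c0 z + poly r4c1 z * \<kappa> + poly r4c2 z * \<kappa>^2 + poly r4c3 z * \<kappa>^3"

definition R3_cofactor :: "real \<Rightarrow> real \<Rightarrow> real" where
  "R3_cofactor z \<kappa> = poly r3c0 z + poly r3c1 z * \<kappa> + poly r3c2 z * \<kappa>^2 + poly r3c3 z * \<kappa>^3 +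
    poly r3c4 z * \<kappa>^4 + poly r3c5 z * \<kappa>^5 + poly r3c6 z * \<kappa>^6"

lemmas r3_defs = r3_0_def r3_1_def r3_2_def r3_3_def r3_4_def r3_5_def r3_6_def r3_7_def r3_8_def

lemmas r4_defs = r4_0_def r4_1_def r4_2_def r4_3_def r4_4_def

lemmas r3c_defs = r3c0_def r3c1_def r3c2_def r3c3_def r3c4_def r3c5_def r3c6_def

lemmas r4c_defs = r4c0_def r4c1_def r4c2_def r4c3_def

lemmas coeff_simps = X_def Y_def P_def Q_def V_def numeral_poly eval_nat_numeral

section \<open>Factorisation of \<open>R3\<close> and \<open>R4\<close> by the Jury
  expressions\<close>

lemma R3_symmetric:
  "R3 c1 c2 k = (let x = c1 * c2; y = (c1 - c2)^2 in
     r3_0 x y + r3_1 x y * k + r3_2 x y * k^2 + r3_3 x y * k^3 + r3_4 x y * k^4 +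
     r3_5 x y * k^5 + r3_6 x y * k^6 + r3_7 x y * k^7 + r3_8 x y * k^8)"
  unfolding R3_def r3_defs Let_def by algebra

lemma R4_symmetric:
  "R4 c1 c2 k = (let x = c1 * c2; y = (c1 - c2)^2 in
     r4_0 x y + r4_1 x y * k + r4_2 x y * k^2 + r4_3 x y * k^3 + r4_4 x y * k^4)"
  unfolding R4_def r4_defs Let_def by algebra

text \<open>\<open>r3_j\<close> is homogeneous of degree \<open>10 - j\<close>, so with
  \<open>k = s \<kappa>\<close> every term of \<open>R3\<close> carries the factor
  \<open>s^10\<close>.\<close>

lemma r3_scale:
  "r3_0 (s * x) (s * y) = s^10 * r3_0 x y"
  "r3_1 (s * x) (s * y) = s^9 * r3_1 x y"
  "r3_2 (s * x) (s * y) = s^8 * r3_2 x y"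
  "r3_3 (s * x) (s * y) = s^7 * r3_3 x y"
  "r3_4 (s * x) (s * y) = s^6 * r3_4 x y"
  "r3_5 (s * x) (s * y) = s^5 * r3_5 x y"
  "r3_6 (s * x) (s * y) = s^4 * r3_6 x y"
  "r3_7 (s * x) (s * y) = s^3 * r3_7 x y"
  "r3_8 (s * x) (s * y) = s^2 * r3_8 x y" for s x y :: real
  unfolding r3_defs by algebra+

lemma r4_scale:
  "r4_0 (s * x) (s * y) = s^6 * r4_0 x y"
  "r4_1 (s * x) (s * y) = s^5 * r4_1 x y"
  "r4_2 (s * x) (s * y) = s^4 * r4_2 x y"
  "r4_3 (s * x) (s * y) = s^3 * r4_3 x y"
  "r4_4 (s * x) (s * y) = s^2 * r4_4 x y" for s x y :: real
  unfolding r4_defs by algebra+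

text \<open>The forms live over any commutative ring, so identities at \<open>X\<close> and
  \<open>Y\<close> can be checked in the polynomial ring and then evaluated.\<close>

lemma poly_r3:
  "poly (r3_0 p q) z = r3_0 (poly p z) (poly q z)"
  "poly (r3_1 p q) z = r3_1 (poly p z) (poly q z)"
  "poly (r3_2 p q) z = r3_2 (poly p z) (poly q z)"
  "poly (r3_3 p q) z = r3_3 (poly p z) (poly q z)"
  "poly (r3_4 p q) z = r3_4 (poly p z) (poly q z)"
  "poly (r3_5 p q) z = r3_5 (poly p z) (poly q z)"
  "poly (r3_6 p q) z = r3_6 (poly p z) (poly q z)"
  "poly (r3_7 p q) z = r3_7 (poly p z) (poly q z)"
  "poly (r3_8 p q) z = r3_8 (poly p z) (poly q z)"
  by (simp_all add: r3_defs)

lemma poly_r4: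
  "poly (r4_0 p q) z = r4_0 (poly p z) (poly q z)"
  "poly (r4_1 p q) z = r4_1 (poly p z) (poly q z)"
  "poly (r4_2 p q) z = r4_2 (poly p z) (poly q z)"
  "poly (r4_3 p q) z = r4_3 (poly p z) (poly q z)"
  "poly (r4_4 p q) z = r4_4 (poly p z) (poly q z)"
  by (simp_all add: r4_defs)

text \<open>Compares the powers of \<open>\<kappa>\<close> in the product of \<open>det_jury\<close>
  and \<open>R4_cofactor\<close>.\<close>

lemma r4_XY:
  "r4_0 X Y = 6 * P * V^2 * X^2 * r4c0"
  "r4_1 X Y = 6 * P * V^2 * X^2 * r4c1 - Q * r4c0"
  "r4_2 X Y = 6 * P * V^2 * X^2 * r4c2 - Q * r4c1"
  "r4_3 X Y = 6 * P * V^2 * X^2 * r4c3 - Q * r4c2"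
  "r4_4 X Y = - Q * r4c3"
  by (simp_all add: r4_defs r4c_defs coeff_simps)

lemma r3_XY:
  "r3_0 X Y = 16 * V^2 * X^5 * r3c0"
  "r3_1 X Y = 16 * V^2 * X^5 * r3c1 - 12 * P * V^2 * X^2 * r3c0"
  "r3_2 X Y = 16 * V^2 * X^5 * r3c2 - 12 * P * V^2 * X^2 * r3c1 + Q * r3c0"
  "r3_3 X Y = 16 * V^2 * X^5 * r3c3 - 12 * P * V^2 * X^2 * r3c2 + Q * r3c1"
  "r3_4 X Y = 16 * V^2 * X^5 * r3c4 - 12 * P * V^2 * X^2 * r3c3 + Q * r3c2"
  "r3_5 X Y = 16 * V^2 * X^5 * r3c5 - 12 * P * V^2 * X^2 * r3c4 + Q * r3c3"
  "r3_6 X Y = 16 * V^2 * X^5 * r3c6 - 12 * P * V^2 * X^2 * r3c5 + Q * r3c4"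
  "r3_7 X Y = - 12 * P * V^2 * X^2 * r3c6 + Q * r3c5"
  "r3_8 X Y = Q * r3c6"
  by (simp_all add: r3_defs r3c_defs coeff_simps)

lemma R4_factor:
  assumes "c1 * c2 = s * poly X z" and "(c1 - c2)^2 = s * poly Y z"
  shows "R4 c1 c2 (s * \<kappa>) = s^6 * (det_jury z \<kappa> * R4_cofactor z \<kappa>)"
  unfolding R4_symmetric Let_def assms r4_scale poly_r4[symmetric] r4_XY det_jury_def R4_cofactor_def
    poly_mult poly_diff poly_minus
  by algebra

lemma R3_factor:
  assumes "c1 * c2 = s * poly X z" and "(c1 - c2)^2 = s * poly Y z"
  shows "R3 c1 c2 (s * \<kappa>) = s^10 * (trace_jury z \<kappa> * R3_cofactor z \<kappa>)"
  unfolding R3_symmetric Let_def assms r3_scale poly_r3[symmetric] r3_XY trace_jury_def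
    R3_cofactor_def poly_mult poly_diff poly_add poly_minus
  by algebra

section \<open>Signs of the cofactors\<close>

lemma poly_pos: "0 < poly X z" "0 < poly P z" "0 < poly Q z" "0 < poly V z" if "0 \<le> z"
  using that by (simp_all add: X_def P_def Q_def V_def add_pos_nonneg)

text \<open>Only \<open>r4c2\<close> has negative coefficients. The hypothesis bounds
  \<open>\<kappa>\<close> below by \<open>6 P V^2 X^2 / Q\<close>, where the cubic term already
  compensates the quadratic one.\<close>

lemma R4_cofactor_nonneg:
  assumes z: "0 \<le> z" and \<kappa>: "0 \<le> \<kappa>" and "det_jury z \<kappa> \<le> 0"
  shows "0 \<le> R4_cofactor z \<kappa>"
proof -
  have "0 \<le> poly (Q * r4c2 + 6 * P * V^2 * X^2 * r4c3) z"
    by (rule poly_nonneg[OF _ z]) (simp add: r4c_defs coeff_simps)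
  moreover have "poly (6 * P * V^2 * X^2) z * poly r4c3 z \<le> poly Q z * \<kappa> * poly r4c3 z"
    using assms(3) poly_nonneg[OF _ z, of r4c3]
    by (intro mult_right_mono) (simp_all add: det_jury_def r4c_defs)
  ultimately have "0 \<le> poly Q z * (poly r4c2 z + poly r4c3 z * \<kappa>)"
    by (simp add: algebra_simps)
  then have "0 \<le> \<kappa>^2 * (poly r4c2 z + poly r4c3 z * \<kappa>)"
    using poly_pos(3)[OF z] by (simp add: zero_le_mult_iff)
  moreover have "0 \<le> poly r4c0 z" "0 \<le> poly r4c1 z * \<kappa>"
    using poly_nonneg[OF _ z, of r4c0] poly_nonneg[OF _ z, of r4c1] \<kappa>
    by (simp_all add: r4c_defs)
  ultimately show ?thesis
    by (simp add: R4_cofactor_def algebra_simps power2_eq_square power3_eq_cube)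
qed

text \<open>Dropping the nonnegative \<open>Q \<kappa>^2\<close> leaves a linear inequality, from
  which \<open>4 V^2 X^2\<close> cancels.\<close>

lemma trace_jury_lower_bound:
  assumes z: "0 \<le> z" and "trace_jury z \<kappa> \<le> 0"
  shows "poly (4 * X^3) z \<le> poly (3 * P) z * \<kappa>"
proof -
  have "0 \<le> poly Q z * \<kappa>^2"
    using poly_pos(3)[OF z] by simp
  then have "4 * poly V z^2 * poly X z^2 * poly (4 * X^3) z
      \<le> 4 * poly V z^2 * poly X z^2 * (poly (3 * P) z * \<kappa>)"
    using assms(2) by (simp add: trace_jury_def algebra_simps eval_nat_numeral)
  then show ?thesis
    using poly_pos[OF z] by (subst (asm) mult_le_cancel_left_pos) auto
qed

text \<open>Above the bound \<open>n / d\<close> the two lowest terms together are nonnegative; the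
  rest is \<open>\<kappa>^2\<close> times a quartic, minorised by a cubic within reach of
  \<open>cubic_nonneg\<close>.\<close>

lemma R3_cofactor_nonneg:
  assumes z: "0 \<le> z" and \<kappa>: "0 \<le> \<kappa>" and "trace_jury z \<kappa> \<le> 0"
  shows "0 \<le> R3_cofactor z \<kappa>"
proof -
  define n where "n = 4 * X^3"
  define d where "d = 3 * P"
  have d: "0 < poly d z" and nd: "poly n z \<le> poly d z * \<kappa>"
    using poly_pos(2)[OF z] trace_jury_lower_bound[OF z assms(3)] by (simp_all add: n_def d_def)
  have "0 \<le> poly (d * r3c0 + n * r3c1) z"
    by (rule poly_nonneg[OF _ z]) (simp add: n_def d_def r3c_defs coeff_simps)
  also have "\<dots> \<le> poly d z * (poly r3c0 z + poly r3c1 z * \<kappa>)"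
    using mult_right_mono[OF nd, of "poly r3c1 z"] poly_nonneg[OF _ z, of r3c1]
    by (simp add: r3c_defs algebra_simps)
  finally have 1: "0 \<le> poly r3c0 z + poly r3c1 z * \<kappa>"
    using d by (simp add: zero_le_mult_iff)
  \<comment> \<open>the tangent to \<open>\<kappa>\<^sup>2\<close> at a numerically chosen \<open>w\<close> lowers the degree of the quartic by one\<close>
  define w where "w = [:300, 8000, 5000 :: real:]"
  have 2: "0 \<le> poly r3c2 z + poly r3c3 z * \<kappa> + poly (r3c4 - r3c6 * w^2) z * \<kappa>^2 +
      poly (r3c5 + 2 * r3c6 * w) z * \<kappa>^3"
  proof (rule cubic_nonneg[OF d nd])
    show "0 \<le> poly (r3c5 + 2 * r3c6 * w) z"
      by (rule poly_nonneg[OF _ z]) (simp add: w_def r3c_defs coeff_simps)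
    have "0 \<le> poly ((r3c4 - r3c6 * w^2) * d + 3 * (r3c5 + 2 * r3c6 * w) * n) z"
      by (rule poly_nonneg[OF _ z]) (simp add: w_def n_def d_def r3c_defs coeff_simps)
    then show "0 \<le> poly (r3c4 - r3c6 * w^2) z * poly d z +
        3 * poly (r3c5 + 2 * r3c6 * w) z * poly n z"
      by simp
    have "0 \<le> poly (r3c3 * d^2 + 2 * (r3c4 - r3c6 * w^2) * n * d +
        3 * (r3c5 + 2 * r3c6 * w) * n^2) z"
      by (rule poly_nonneg[OF _ z]) (simp add: w_def n_def d_def r3c_defs coeff_simps)
    then show "0 \<le> poly r3c3 z * poly d z^2 + 2 * poly (r3c4 - r3c6 * w^2) z * poly n z * poly d z +
        3 * poly (r3c5 + 2 * r3c6 * w) z * poly n z^2"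
      by simp
    have "0 \<le> poly (r3c2 * d^3 + r3c3 * n * d^2 + (r3c4 - r3c6 * w^2) * n^2 * d +
        (r3c5 + 2 * r3c6 * w) * n^3) z"
      by (rule poly_nonneg[OF _ z]) (simp add: w_def n_def d_def r3c_defs coeff_simps)
    then show "0 \<le> poly r3c2 z * poly d z^3 + poly r3c3 z * poly n z * poly d z^2 +
        poly (r3c4 - r3c6 * w^2) z * poly n z^2 * poly d z +
        poly (r3c5 + 2 * r3c6 * w) z * poly n z^3"
      by simp
  qed
  have "0 \<le> poly r3c6 z"
    by (rule poly_nonneg[OF _ z]) (simp add: r3c_defs)
  \<comment> \<open>The square discarded by the tangent, weighted by \<open>r3c6 \<kappa>^4\<close>,
    restores the cofactor exactly.\<close>
  then have "0 \<le> (poly r3c0 z + poly r3c1 z * \<kappa>) +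
      \<kappa>^2 * (poly r3c2 z + poly r3c3 z * \<kappa> + poly (r3c4 - r3c6 * w^2) z * \<kappa>^2 +
      poly (r3c5 + 2 * r3c6 * w) z * \<kappa>^3) + poly r3c6 z * \<kappa>^4 * (\<kappa> - poly w z)^2"
    using 1 2 by simp
  also have "\<dots> = R3_cofactor z \<kappa>"
    unfolding R3_cofactor_def poly_diff poly_add poly_mult poly_power poly_numeral by algebra
  finally show ?thesis .
qed

section \<open>The asymmetric conditions\<close>

text \<open>The admissible values of \<open>(c1\<^sup>2, c1 c2, k)\<close> form a cone over a quadrilateral. The form \<open>A2\<close> has
  nonnegative coefficients in barycentric coordinates on each of the two triangles cut off by the
  diagonal through the rays \<open>(1, 0, 27)\<close> and \<open>(1, 1, 16)\<close>.\<close>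

lemma A2_nonneg:
  assumes "0 < c2" and "c2 \<le> c1" and lb: "16 * c1 * c2 \<le> k" and A1: "0 < A1 c1 c2 k"
  shows "0 \<le> A2 c1 c2 k"
proof -
  define g where "g = c1^2"
  define x where "x = c1 * c2"
  have x: "0 \<le> x" and xg: "x \<le> g" and lb: "16 * x \<le> k" and ub: "9 * k \<le> 243 * g + 352 * x"
    using assms by (simp_all add: A1_def g_def x_def power2_eq_square mult.assoc)
  have A2: "A2 c1 c2 k = -8000 * g * x^3 + 19683 * g^3 * k - 17496 * g^2 * x * k +
      3024 * g * x^2 * k + 1728 * x^3 * k - 2187 * g^2 * k^2 + 3564 * g * x * k^2 -
      432 * x^2 * k^2 + 81 * g * k^3 + 36 * x * k^3 - k^4"
    unfolding A2_def g_def x_def by algebra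
  show ?thesis
  proof (cases "k \<le> 27 * (g - x) + 16 * x")
    case True
    \<comment> \<open>Here
      \<open>(g, x, k) = a (1, 0, 0) + b (1, 0, 27) + x (1, 1, 16)\<close>.\<close>
    define a where "a = g - x - (k - 16 * x) / 27"
    define b where "b = (k - 16 * x) / 27"
    have "0 \<le> a" "0 \<le> b"
      using True lb by (simp_all add: a_def b_def field_simps)
    then have "0 \<le> 531441 * a^3 * b + 314928 * a^3 * x + 177147 * a^2 * b * x + 104976 * a^2 * x^2
        + 1653372 * a * b^2 * x + 1920915 * a * b * x^2 + 549712 * a * x^3 + 2834352 * b^3 * x
        + 5479164 * b^2 * x^2 + 3537289 * b * x^3 + 758640 * x^4"
      using x by simp
    also have "\<dots> = A2 c1 c2 k"
    proof -
      have kg: "k = 27 * b + 16 * x" "g = a + b + x"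
        by (simp_all add: a_def b_def field_simps)
      show ?thesis
        unfolding A2 unfolding kg by algebra
    qed
    finally show ?thesis .
  next
    case False
    \<comment> \<open>Here \<open>(g, x, k) = a (1, 0, 27) + b (1, 1, 16) + d (9, 9, 595)\<close>;
      on the last ray \<open>x = g\<close> meets \<open>A1 = 0\<close>.\<close>
    define a where "a = g - x"
    define d where "d = (k - 27 * (g - x) - 16 * x) / 451"
    define b where "b = x - 9 * d"
    have "0 \<le> a" "0 \<le> b" "0 \<le> d"
      using False xg ub by (simp_all add: a_def b_def d_def field_simps)
    then have "0 \<le> 2834352 * a^3 * b + 25509168 * a^3 * d + 5479164 * a^2 * b^2
        + 213040044 * a^2 * b * d + 1473548112 * a^2 * d^2 + 3537289 * a * b^3
        + 246465072 * a * b^2 * d + 5076078840 * a * b * d^2 + 25822908432 * a * d^3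
        + 758640 * b^4 + 77214641 * b^3 * d + 2738186292 * b^2 * d^2 + 37598283836 * b * d^3
        + 126531534320 * d^4"
      by simp
    also have "\<dots> = A2 c1 c2 k"
    proof -
      have kg: "k = 27 * a + 16 * b + 595 * d" "g = a + b + 9 * d" "x = b + 9 * d"
        by (simp_all add: a_def b_def d_def field_simps)
      show ?thesis
        unfolding A2 unfolding kg by algebra
    qed
    finally show ?thesis .
  qed
qed

definition a3_0 :: "'a::comm_ring_1 \<Rightarrow> 'a \<Rightarrow> 'a" where
  "a3_0 x y = 12754584 * x^7 - 12171384 * x^6 * y + 3708504 * x^5 * y^2 + 84096 * x^4 * y^3
    + 2519424 * x^3 * y^4"

definition a3_1 :: "'a::comm_ring_1 \<Rightarrow> 'a \<Rightarrow> 'a" where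
  "a3_1 x y = - 72171 * x^5 - 3576744 * x^4 * y + 5126856 * x^3 * y^2 - 629856 * x^2 * y^3"

definition a3_2 :: "'a::comm_ring_1 \<Rightarrow> 'a \<Rightarrow> 'a" where
  "a3_2 x y = - 25272 * x^3 + 98966 * x^2 * y + 52488 * x * y^2"

definition a3_3 :: "'a::comm_ring_1 \<Rightarrow> 'a \<Rightarrow> 'a" where
  "a3_3 x y = 387 * x - 1458 * y"

lemmas a3_defs = a3_0_def a3_1_def a3_2_def a3_3_def

text \<open>\<open>A3\<close> is homogeneous of degree 7 if the costs have weight 1 and
  \<open>k\<close> has weight 2.\<close>

lemma A3_expand:
  "A3 (m * x) (m * y) (m^2 * k) =
    m^7 * (a3_0 x y + a3_1 x y * k + a3_2 x y * k^2 + a3_3 x y * k^3)"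
  unfolding A3_def a3_defs by algebra

lemma poly_a3:
  "poly (a3_0 p q) v = a3_0 (poly p v) (poly q v)"
  "poly (a3_1 p q) v = a3_1 (poly p v) (poly q v)"
  "poly (a3_2 p q) v = a3_2 (poly p v) (poly q v)"
  "poly (a3_3 p q) v = a3_3 (poly p v) (poly q v)"
  by (simp_all add: a3_defs)

text \<open>Up to the scale \<open>m\<close>, the ratio equation parametrises the costs by
  \<open>t = b / a\<close>, and the bound on \<open>k\<close> is
  \<open>4 X^3 \<le> 3 P \<kappa>\<close> cleared of denominators. After the shift
  \<open>v = t - 1\<close>, the Taylor coefficients of \<open>- A3\<close> at this bound, cleared of
  denominators, are polynomials in \<open>v\<close> with nonnegative coefficients.\<close>

lemma A3_nonpos:
  assumes m: "0 < m" and t: "1 \<le> t" and k: "4 * t^3 * ((2 * t + 3) * (3 * t + 2))^3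
      \<le> 3 * (3 * t^4 - t^3 + t^2 - t + 3) * k"
  shows "A3 (m * (3 * t + 2)) (m * (t^3 * (2 * t + 3))) (m^2 * k) \<le> 0"
proof -
  define v where "v = t - 1"
  have v: "0 \<le> v" using t by (simp add: v_def)
  define x where "x = [:5, 3 :: real:]"
  define y where "y = [:1, 1:]^3 * [:5, 2 :: real:]"
  define n where "n = 4 * [:1, 1:]^3 * ([:5, 2:] * [:5, 3 :: real:])^3"
  define d where "d = 3 * [:5, 10, 16, 11, 3 :: real:]"
  have poly: "poly x v = 3 * t + 2" "poly y v = t^3 * (2 * t + 3)"
    "poly n v = 4 * t^3 * ((2 * t + 3) * (3 * t + 2))^3"
    "poly d v = 3 * (3 * t^4 - t^3 + t^2 - t + 3)"
    by (simp_all add: x_def y_def n_def d_def v_def algebra_simps eval_nat_numeral)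
  have d: "0 < poly d v"
    using v by (simp add: d_def add_pos_nonneg)
  have "0 \<le> poly (- a3_0 x y) v + poly (- a3_1 x y) v * k + poly (- a3_2 x y) v * k^2 +
      poly (- a3_3 x y) v * k^3"
  proof (rule cubic_nonneg[OF d])
    show "poly n v \<le> poly d v * k"
      using k by (simp only: poly)
    show "0 \<le> poly (- a3_3 x y) v"
      by (rule poly_nonneg[OF _ v]) (simp add: a3_defs x_def y_def coeff_simps)
    have "0 \<le> poly (- a3_2 x y * d + 3 * (- a3_3 x y) * n) v"
      by (rule poly_nonneg[OF _ v]) (simp add: a3_defs x_def y_def n_def d_def coeff_simps)
    then show "0 \<le> poly (- a3_2 x y) v * poly d v + 3 * poly (- a3_3 x y) v * poly n v"
      by simp
    have "0 \<le> poly (- a3_1 x y * d^2 + 2 * (- a3_2 x y) * n * d + 3 * (- a3_3 x y) * n^2) v"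
      by (rule poly_nonneg[OF _ v]) (simp add: a3_defs x_def y_def n_def d_def coeff_simps)
    then show "0 \<le> poly (- a3_1 x y) v * poly d v^2 + 2 * poly (- a3_2 x y) v * poly n v * poly d v
        + 3 * poly (- a3_3 x y) v * poly n v^2"
      by simp
    have "0 \<le> poly (- a3_0 x y * d^3 + (- a3_1 x y) * n * d^2 + (- a3_2 x y) * n^2 * d +
        (- a3_3 x y) * n^3) v"
      by (rule poly_nonneg[OF _ v]) (simp add: a3_defs x_def y_def n_def d_def coeff_simps)
    then show "0 \<le> poly (- a3_0 x y) v * poly d v^3 + poly (- a3_1 x y) v * poly n v * poly d v^2 +
        poly (- a3_2 x y) v * poly n v^2 * poly d v + poly (- a3_3 x y) v * poly n v^3"
      by simp
  qed
  then have "a3_0 (poly x v) (poly y v) + a3_1 (poly x v) (poly y v) * k +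
      a3_2 (poly x v) (poly y v) * k^2 + a3_3 (poly x v) (poly y v) * k^3 \<le> 0"
    by (simp add: poly_a3)
  then show ?thesis
    using m unfolding A3_expand poly by (simp add: mult_le_0_iff)
qed

section \<open>The equilibrium\<close>

text \<open>In the square roots \<open>a\<close>, \<open>b\<close> of the prices, the numerators of
  \<open>G\<close> are \<open>b\<close> and \<open>a\<close> times the defects of the two cubic
  equations.\<close>

lemma positive_equilibrium_iff:
  assumes k: "0 < k"
  shows "positive_equilibrium (G c1 c2 k k) p \<longleftrightarrow> 0 < p$1 \<and> 0 < p$2 \<and>
    sqrt (p$1)^3 = (2 * sqrt (p$2) + 3 * sqrt (p$1)) * c1 \<and>
    sqrt (p$2)^3 = (2 * sqrt (p$1) + 3 * sqrt (p$2)) * c2"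
proof (cases "0 < p$1 \<and> 0 < p$2")
  case True
  define a where "a = sqrt (p$1)"
  define b where "b = sqrt (p$2)"
  have ab: "0 < a" "0 < b" and p: "p$1 = a^2" "p$2 = b^2" and s: "sqrt (p$1 * p$2) = a * b"
    using True by (simp_all add: a_def b_def real_sqrt_mult)
  have num: "- (a^2) * (a * b) + (2 * b^2 + 3 * (a * b)) * c1 = b * ((2 * b + 3 * a) * c1 - a^3)"
    "- (b^2) * (a * b) + (2 * a^2 + 3 * (a * b)) * c2 = a * ((2 * a + 3 * b) * c2 - b^3)"
    by algebra+
  have "G c1 c2 k k p = p \<longleftrightarrow> (2 * b + 3 * a) * c1 - a^3 = 0 \<and> (2 * a + 3 * b) * c2 - b^3 = 0"
    using ab k
    unfolding vec_eq_iff forall_2 G_def vector_2 s a_def[symmetric] b_def[symmetric]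
    unfolding p num by simp
  then show ?thesis
    using True unfolding positive_equilibrium_def a_def b_def by auto
qed (auto simp: positive_equilibrium_def)

section \<open>Existence and uniqueness of the positive equilibrium\<close>

lemma ratio_unique:
  fixes a b a' b' c1 c2 :: real
  assumes pos: "0 < a" "0 < b" "0 < a'" "0 < b'" "0 < c1" "0 < c2"
    and "a^3 = (2 * b + 3 * a) * c1" "b^3 = (2 * a + 3 * b) * c2"
    and "a'^3 = (2 * b' + 3 * a') * c1" "b'^3 = (2 * a' + 3 * b') * c2"
  shows "b / a = b' / a'"
proof -
  have eq: "t^3 * (2 * t + 3) * c1 = (3 * t + 2) * c2"
    if "0 < a" "0 < b" "a^3 = (2 * b + 3 * a) * c1" "b^3 = (2 * a + 3 * b) * c2" "t = b / a"
    for a b t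
  proof -
    have b: "b = t * a" using that by simp
    have "a^4 * (t^3 * (2 * t + 3) * c1) = a^4 * ((3 * t + 2) * c2)"
      using that(3,4) unfolding b by algebra
    then show ?thesis using that(1) by simp
  qed
  \<comment> \<open>Strict monotonicity of \<open>t^3 (2t + 3) / (3t + 2)\<close>, as a product of
    the increasing functions \<open>t^2 (2t + 3)\<close> and \<open>t / (3t + 2)\<close>.\<close>
  have less: False
    if t: "0 < t" "t < u" "t^3 * (2 * t + 3) * c1 = (3 * t + 2) * c2"
      "u^3 * (2 * u + 3) * c1 = (3 * u + 2) * c2" for t u
  proof -
    have "t^2 < u^2"
      using t by (intro power_strict_mono) auto
    then have "t^2 * (2 * t + 3) < u^2 * (2 * u + 3)"
      using t by (intro mult_strict_mono) auto
    moreover have "t * (3 * u + 2) < u * (3 * t + 2)"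
      using t by (simp add: algebra_simps)
    ultimately have "(t^2 * (2 * t + 3)) * (t * (3 * u + 2)) < (u^2 * (2 * u + 3)) * (u * (3 * t + 2))"
      by (rule mult_strict_mono) (use t in auto)
    then have "c1 * ((t^2 * (2 * t + 3)) * (t * (3 * u + 2))) <
        c1 * ((u^2 * (2 * u + 3)) * (u * (3 * t + 2)))"
      using pos(5) by simp
    moreover have "c1 * ((t^2 * (2 * t + 3)) * (t * (3 * u + 2))) =
        c1 * ((u^2 * (2 * u + 3)) * (u * (3 * t + 2)))"
      using t(3,4) by algebra
    ultimately show False by simp
  qed
  show ?thesis
    using less[of "b / a" "b' / a'"] less[of "b' / a'" "b / a"] eq[OF pos(1,2) assms(7,8) refl]
      eq[OF pos(3,4) assms(9,10) refl] pos(1-4)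
    by (meson divide_pos_pos linorder_neqE_linordered_idom)
qed

lemma ratio_exists:
  fixes c1 c2 :: real
  assumes "0 < c1" "0 < c2"
  obtains t where "0 < t" "t^3 * (2 * t + 3) * c1 = (3 * t + 2) * c2"
proof -
  define f where "f t = t^3 * (2 * t + 3) * c1 - (3 * t + 2) * c2" for t
  \<comment> \<open>This endpoint satisfies \<open>T c1 = c1 + c2\<close>, which with
    \<open>T \<ge> 1\<close> makes \<open>f T\<close> nonnegative.\<close>
  define T where "T = 1 + c2 / c1"
  have T: "1 \<le> T" "T * c1 = c1 + c2"
    using assms by (simp_all add: T_def field_simps)
  have "(3 * T + 2) * c2 \<le> (3 * T + 2) * (c1 + c2)"
    using assms T(1) by (intro mult_left_mono) auto
  also have "\<dots> \<le> (3 * T^2 + 2 * T^3) * (c1 + c2)"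
    using T(1) assms power_increasing[of 1 2 T] one_le_power[of T 3]
    by (intro mult_right_mono add_mono) auto
  also have "\<dots> = T^3 * (2 * T + 3) * c1"
    unfolding T(2)[symmetric] by algebra
  finally have "0 \<le> f T"
    by (simp add: f_def)
  moreover have "f 0 \<le> 0" "0 \<le> T"
    using assms T by (simp_all add: f_def)
  moreover have "continuous_on {0..T} f"
    unfolding f_def by (intro continuous_intros)
  ultimately obtain t where t: "0 \<le> t" "f t = 0"
    using IVT'[of f 0 0 T] by auto
  with assms have "t \<noteq> 0"
    by (auto simp: f_def)
  with t that[of t] show thesis
    by (simp add: f_def)
qed

text \<open>The ratio \<open>t\<close> is determined first; putting \<open>b = t a\<close> into the
  first cubic equation then fixes \<open>a^2 = (2t + 3) c1\<close>.\<close>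

lemma ex1_positive_equilibrium:
  assumes c: "0 < c1" "0 < c2" and k: "0 < k"
  shows "\<exists>!p. positive_equilibrium (G c1 c2 k k) p"
proof (rule ex_ex1I)
  obtain t where t: "0 < t" "t^3 * (2 * t + 3) * c1 = (3 * t + 2) * c2"
    using ratio_exists[OF c] .
  define a where "a = sqrt ((2 * t + 3) * c1)"
  have a: "0 < a" "a^2 = (2 * t + 3) * c1"
    using t c by (simp_all add: a_def)
  have "sqrt (a^2) = a" "sqrt ((t * a)^2) = t * a"
    using a(1) t(1) by simp_all
  moreover have "a^3 = (2 * (t * a) + 3 * a) * c1"
    using a(2) by algebra
  moreover have "(t * a)^3 = (2 * a + 3 * (t * a)) * c2"
    using a(2) t(2) by algebra
  ultimately have "positive_equilibrium (G c1 c2 k k) (vector [a^2, (t * a)^2])"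
    using a(1) t(1) by (simp only: positive_equilibrium_iff[OF k] vector_2) simp
  then show "\<exists>p. positive_equilibrium (G c1 c2 k k) p" ..
next
  fix p q
  assume p: "positive_equilibrium (G c1 c2 k k) p" and q: "positive_equilibrium (G c1 c2 k k) q"
  define a where "a = sqrt (p$1)"
  define b where "b = sqrt (p$2)"
  define a' where "a' = sqrt (q$1)"
  define b' where "b' = sqrt (q$2)"
  have ab: "0 < a" "0 < b" "0 < a'" "0 < b'"
    and e: "a^3 = (2 * b + 3 * a) * c1" "b^3 = (2 * a + 3 * b) * c2"
      "a'^3 = (2 * b' + 3 * a') * c1" "b'^3 = (2 * a' + 3 * b') * c2"
    using p q unfolding positive_equilibrium_iff[OF k] a_def b_def a'_def b'_def by auto
  define t where "t = b / a"
  have t': "t = b' / a'"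
    unfolding t_def by (rule ratio_unique[OF ab c e])
  have b: "b = t * a" "b' = t * a'"
    using ab by (simp add: t_def) (use ab in \<open>simp add: t'\<close>)
  have "a * a^2 = a * ((2 * t + 3) * c1)" "a' * a'^2 = a' * ((2 * t + 3) * c1)"
    using e(1,3) unfolding b by algebra+
  with ab have "a^2 = a'^2"
    by simp
  with ab have "a = a'"
    by (simp add: power2_eq_iff_nonneg)
  moreover from this have "b = b'"
    using b by simp
  ultimately show "p = q"
    unfolding a_def b_def a'_def b'_def by (simp add: vec_eq_iff forall_2)
qed

section \<open>Linear stability of planar maps\<close>

text \<open>Eliminating either component between the two rows shows that the characteristic
  polynomial at \<open>z\<close> annihilates both, and one of them is nonzero.\<close>

lemma complex_eigenvalue_2:
  fixes M :: "real^2^2"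
  assumes "complex_eigenvalue M z"
  shows "z^2 - of_real (M$1$1 + M$2$2) * z + of_real (M$1$1 * M$2$2 - M$1$2 * M$2$1) = 0"
proof -
  obtain v :: "complex^2" where v: "v \<noteq> 0"
    and e: "(\<chi> i j. complex_of_real (M$i$j)) *v v = z *s v"
    using assms unfolding complex_eigenvalue_def by blast
  have e1: "of_real (M$1$1) * v$1 + of_real (M$1$2) * v$2 = z * v$1"
    using arg_cong[OF e, of "\<lambda>w. w$1"] by (simp add: matrix_vector_mult_def sum_2)
  have e2: "of_real (M$2$1) * v$1 + of_real (M$2$2) * v$2 = z * v$2"
    using arg_cong[OF e, of "\<lambda>w. w$2"] by (simp add: matrix_vector_mult_def sum_2)
  let ?q = "z^2 - of_real (M$1$1 + M$2$2) * z + of_real (M$1$1 * M$2$2 - M$1$2 * M$2$1)"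
  have "?q * v$1 = 0" "?q * v$2 = 0"
    using e1 e2 unfolding of_real_add of_real_diff of_real_mult by algebra+
  with v show ?thesis
    by (auto simp: vec_eq_iff forall_2)
qed

text \<open>A non-real root has its conjugate as the other root, so \<open>D\<close> is its squared
  modulus. For a real root \<open>x\<close> with other root \<open>w\<close>, the conditions say
  that \<open>1 - x\<close> and \<open>1 - w\<close> have equal signs, likewise \<open>1 + x\<close>
  and \<open>1 + w\<close>, and that \<open>x w < 1\<close>.\<close>

lemma jury_criterion:
  fixes T D :: real and z :: complex
  assumes z: "z^2 - of_real T * z + of_real D = 0"
    and jury: "0 < 1 - T + D" "0 < 1 + T + D" "0 < 1 - D"
  shows "cmod z < 1"
proof -
  define x where "x = Re z"
  define y where "y = Im z"
  have re: "x^2 - y^2 - T * x + D = 0" and im: "y * (2 * x - T) = 0"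
    using arg_cong[OF z, of Re] arg_cong[OF z, of Im]
    by (simp_all add: x_def y_def power2_eq_square algebra_simps)
  have "x^2 + y^2 < 1"
  proof (cases "y = 0")
    case False
    then have "T = 2 * x"
      using im by simp
    with re have "x^2 + y^2 = D"
      by (simp add: power2_eq_square algebra_simps)
    then show ?thesis using jury by simp
  next
    case True
    then have D: "D = x * (T - x)"
      using re by (simp add: power2_eq_square algebra_simps)
    define w where "w = T - x"
    have pos: "0 < (1 - x) * (1 - w)" "0 < (1 + x) * (1 + w)" and less: "x * w < 1"
      using jury unfolding D w_def by (simp_all add: algebra_simps)
    have "\<not> 1 \<le> x"
    proof
      assume "1 \<le> x"
      then have "1 \<le> w"
        using pos(1) by (auto simp: zero_less_mult_iff)
      then show False
        using less mult_mono[of 1 x 1 w] \<open>1 \<le> x\<close> by simp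
    qed
    moreover have "\<not> x \<le> -1"
    proof
      assume "x \<le> -1"
      then have "w \<le> -1"
        using pos(2) by (auto simp: zero_less_mult_iff)
      then show False
        using less mult_mono[of 1 "-x" 1 "-w"] \<open>x \<le> -1\<close> by simp
    qed
    ultimately have "\<bar>x\<bar> < 1"
      by simp
    then show ?thesis
      using True by (simp add: abs_square_less_1)
  qed
  then show ?thesis
    by (simp add: cmod_def x_def y_def)
qed

lemma has_derivative_vector_2:
  fixes f g :: "'a::real_normed_vector \<Rightarrow> real"
  assumes "(f has_derivative f') F" and "(g has_derivative g') F"
  shows "((\<lambda>x. vector [f x, g x] :: real^2) has_derivative (\<lambda>h. vector [f' h, g' h])) F"
proof -
  have eq: "vector [u, v] = u *\<^sub>R axis 1 1 + v *\<^sub>R (axis 2 1 :: real^2)" for u v :: real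
    by (simp add: vec_eq_iff forall_2 axis_def)
  show ?thesis
    unfolding eq by (intro derivative_intros assms)
qed

lemma locally_stable_2:
  fixes f :: "real^2 \<Rightarrow> real^2"
  assumes f: "(f has_derivative (\<lambda>h. vector [m11 * h$1 + m12 * h$2, m21 * h$1 + m22 * h$2])) (at p)"
    and jury: "0 < 1 - (m11 + m22) + (m11 * m22 - m12 * m21)"
      "0 < 1 + (m11 + m22) + (m11 * m22 - m12 * m21)" "0 < 1 - (m11 * m22 - m12 * m21)"
  shows "locally_stable f p"
proof -
  have "f differentiable at p"
    using f by (rule differentiableI)
  moreover have "jacobian f (at p) $ 1 $ 1 = m11" "jacobian f (at p) $ 1 $ 2 = m12"
    "jacobian f (at p) $ 2 $ 1 = m21" "jacobian f (at p) $ 2 $ 2 = m22"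
    unfolding jacobian_def frechet_derivative_at[OF f, symmetric]
    by (simp_all add: matrix_def axis_def)
  ultimately show ?thesis
    using jury_criterion[OF _ jury] complex_eigenvalue_2[of "jacobian f (at p)"]
    unfolding locally_stable_def by auto
qed

text \<open>At an equilibrium the numerator vanishes, so the quotient rule leaves only the
  derivative of the numerator over the denominator; the equilibrium equation eliminates
  \<open>c\<close>.\<close>

lemma has_derivative_price:
  fixes p :: "real^2" and i j :: 2
  defines "a \<equiv> sqrt (p$i)" and "b \<equiv> sqrt (p$j)"
  assumes p: "0 < p$i" "0 < p$j" and e: "a^3 = (2 * b + 3 * a) * c"
  shows "((\<lambda>p. p$i + k * ((- p$i * sqrt (p$i * p$j) + (2 * p$j + 3 * sqrt (p$i * p$j)) * c)
      / (2 * (p$i)^2 * (sqrt (p$i) + sqrt (p$j))^2))) has_derivative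
    (\<lambda>h. (1 - 3 * k * b / (2 * a^3 * (a + b) * (2 * b + 3 * a))) * h$i +
      k / (2 * a * (a + b)^2 * (2 * b + 3 * a)) * h$j)) (at p)"
proof -
  have ab: "0 < a" "0 < b" and sq: "p$i = a^2" "p$j = b^2" and s: "sqrt (p$i * p$j) = a * b"
    using p by (simp_all add: a_def b_def real_sqrt_mult)
  have c: "c = a^3 / (2 * b + 3 * a)"
    using ab e by (simp add: field_simps)
  let ?N = "\<lambda>p. - p$i * sqrt (p$i * p$j) + (2 * p$j + 3 * sqrt (p$i * p$j)) * c"
  let ?D = "\<lambda>p. 2 * (p$i)^2 * (sqrt (p$i) + sqrt (p$j))^2"
  let ?N' = "\<lambda>h. - 3 * a * b * (a + b) / (2 * b + 3 * a) * h$i + a^3 / (2 * b + 3 * a) * h$j"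
  have nz: "a \<noteq> 0" "b \<noteq> 0" "2 * b + 3 * a \<noteq> 0" "a + b \<noteq> 0"
    using ab by simp_all
  have nth: "((\<lambda>p. p$l) has_derivative (\<lambda>h. h$l)) (at p)" for l
    by (rule bounded_linear_imp_has_derivative[OF bounded_linear_vec_nth])
  have root: "((\<lambda>p. sqrt (p$l)) has_derivative (\<lambda>h. h$l * (inverse (sqrt (p$l)) / 2))) (at p)"
    if "0 < p$l" for l
    using has_derivative_real_sqrt[OF that nth] by simp
  have geo: "((\<lambda>p. sqrt (p$i * p$j)) has_derivative
      (\<lambda>h. (p$i * h$j + h$i * p$j) * (inverse (a * b) / 2))) (at p)"
    using has_derivative_real_sqrt[OF _ has_derivative_mult[OF nth[of i] nth[of j]]] p s by simp
  have "(?N has_derivative (\<lambda>h. (- p$i * ((p$i * h$j + h$i * p$j) * (inverse (a * b) / 2)) +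
      - h$i * sqrt (p$i * p$j)) +
      (2 * h$j + 3 * ((p$i * h$j + h$i * p$j) * (inverse (a * b) / 2))) * c)) (at p)"
    by (intro has_derivative_add has_derivative_mult_left has_derivative_mult_right
        has_derivative_mult has_derivative_minus nth geo)
  moreover have "(- p$i * ((p$i * h$j + h$i * p$j) * (inverse (a * b) / 2)) +
      - h$i * sqrt (p$i * p$j)) +
      (2 * h$j + 3 * ((p$i * h$j + h$i * p$j) * (inverse (a * b) / 2))) * c = ?N' h" for h
    unfolding s unfolding sq c using nz by (simp add: divide_simps) algebra
  ultimately have N: "(?N has_derivative ?N') (at p)"
    by simp
  \<comment> \<open>In the quotient rule \<open>D'\<close> is multiplied by \<open>?N p = 0\<close>,
    so its existence suffices.\<close>
  have "\<exists>D'. (?D has_derivative D') (at p)"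
    by (rule exI, rule has_derivative_mult[OF
          has_derivative_mult_right[OF has_derivative_power[OF nth]]
          has_derivative_power[OF has_derivative_add[OF root[OF p(1)] root[OF p(2)]]]])
  then obtain D' where D: "(?D has_derivative D') (at p)" ..
  have N0: "?N p = 0"
    unfolding s unfolding sq using e by algebra
  have Dp: "?D p = 2 * a^4 * (a + b)^2"
    unfolding a_def[symmetric] b_def[symmetric] unfolding sq by algebra
  have D0: "?D p \<noteq> 0"
    unfolding Dp using nz by simp
  have "((\<lambda>p. p$i + k * (?N p / ?D p)) has_derivative
      (\<lambda>h. h$i + k * ((?N' h * ?D p - ?N p * D' h) / (?D p * ?D p)))) (at p)"
    by (intro has_derivative_add nth has_derivative_mult_right has_derivative_divide' N D D0)
  moreover have "h$i + k * ((?N' h * ?D p - ?N p * D' h) / (?D p * ?D p)) =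
      (1 - 3 * k * b / (2 * a^3 * (a + b) * (2 * b + 3 * a))) * h$i +
      k / (2 * a * (a + b)^2 * (2 * b + 3 * a)) * h$j" for h
    unfolding N0 unfolding Dp using nz
    by (simp add: divide_simps) algebra
  ultimately show ?thesis
    by simp
qed

section \<open>The stability conditions\<close>

text \<open>\<open>z\<close> depends only on the ratio of \<open>a\<close> and \<open>b\<close>, and
  \<open>\<kappa>\<close> is a rescaled \<open>k\<close>; the Jury conditions become conditions on
  these two.\<close>

locale equilibrium =
  fixes a b c1 c2 k z \<kappa> :: real
  assumes a: "0 < a" and b: "0 < b" and k: "0 < k" and c1: "0 < c1" and c2: "0 < c2"
    and e1: "a^3 = (2 * b + 3 * a) * c1" and e2: "b^3 = (2 * a + 3 * b) * c2"
  defines "z \<equiv> (b - a)^2 / (a * b)"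
    and "\<kappa> \<equiv> k * poly X z^2 / (a * b)^2"
begin

lemma nonzero: "a \<noteq> 0" "b \<noteq> 0" "a + b \<noteq> 0" "2 * b + 3 * a \<noteq> 0" "2 * a + 3 * b \<noteq> 0"
  using a b by simp_all

lemma z_nonneg: "0 \<le> z"
  using a b by (simp add: z_def)

lemma poly_z:
  "poly X z = (2 * b + 3 * a) * (2 * a + 3 * b) / (a * b)"
  "poly V z = (a + b)^2 / (a * b)"
  "poly Q z = (9 * (a + b)^2 - a * b) / (a * b)"
  "poly P z = (3 * a^4 - a^3 * b + a^2 * b^2 - a * b^3 + 3 * b^4) / (a * b)^2"
  "poly Y z = (a - b)^2 * (a + b)^2 * (2 * a^2 + 3 * a * b + 2 * b^2)^2 / (a * b)^4"
  using nonzero unfolding z_def X_def V_def Q_def P_def Y_def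
  by (simp_all add: field_simps eval_nat_numeral)

lemma costs: "c1 = a^3 / (2 * b + 3 * a)" "c2 = b^3 / (2 * a + 3 * b)"
  using e1 e2 nonzero by (simp_all add: field_simps)

text \<open>This is \<open>c1 c2 / X(z)\<close>, because
  \<open>c1 c2 = (a b)^2 / X(z)\<close>.\<close>

definition "s = (a * b / poly X z)^2"

lemma s_pos: "0 < s"
  using a b poly_pos(1)[OF z_nonneg] by (simp add: s_def)

lemma k_eq: "k = s * \<kappa>"
  using a b poly_pos(1)[OF z_nonneg] by (simp add: s_def \<kappa>_def power_divide)

lemma \<kappa>_pos: "0 < \<kappa>"
  using a b k poly_pos(1)[OF z_nonneg] by (simp add: \<kappa>_def)

lemma c1_c2: "c1 * c2 = s * poly X z"
proof -
  define f where "f = 2 * b + 3 * a"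
  define g where "g = 2 * a + 3 * b"
  have nz: "a \<noteq> 0" "b \<noteq> 0" "f \<noteq> 0" "g \<noteq> 0"
    using nonzero by (simp_all add: f_def g_def)
  show ?thesis
    unfolding s_def poly_z costs f_def[symmetric] g_def[symmetric]
    using nz by (simp add: field_simps eval_nat_numeral)
qed

lemma diff: "c1 - c2 = (a - b) * (a + b) * (2 * a^2 + 3 * a * b + 2 * b^2) /
    ((2 * b + 3 * a) * (2 * a + 3 * b))"
  unfolding costs using nonzero by (simp add: divide_simps) algebra

lemma diff_sq: "(c1 - c2)^2 = s * poly Y z"
proof -
  define d where "d = (2 * b + 3 * a) * (2 * a + 3 * b)"
  have nz: "a \<noteq> 0" "b \<noteq> 0" "d \<noteq> 0"
    using nonzero by (simp_all add: d_def)
  show ?thesis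
    unfolding s_def diff poly_z d_def[symmetric]
    using nz by (simp add: power_divide power_mult_distrib field_simps eval_nat_numeral)
qed

text \<open>The Jacobian at the equilibrium has rows \<open>(1 - \<alpha>, \<gamma>)\<close> and
  \<open>(\<delta>, 1 - \<beta>)\<close>.\<close>

definition "\<alpha> = 3 * k * b / (2 * a^3 * (a + b) * (2 * b + 3 * a))"
definition "\<beta> = 3 * k * a / (2 * b^3 * (b + a) * (2 * a + 3 * b))"
definition "\<gamma> = k / (2 * a * (a + b)^2 * (2 * b + 3 * a))"
definition "\<delta> = k / (2 * b * (b + a)^2 * (2 * a + 3 * b))"

lemma trace_eq: "\<alpha> + \<beta> = 3 * \<kappa> * poly P z / (2 * poly X z^3)"
proof -
  define u where "u = a + b"
  define f where "f = 2 * b + 3 * a"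
  define g where "g = 2 * a + 3 * b"
  define q where "q = 3 * a^4 - a^3 * b + a^2 * b^2 - a * b^3 + 3 * b^4"
  have nz: "a \<noteq> 0" "b \<noteq> 0" "u \<noteq> 0" "f \<noteq> 0" "g \<noteq> 0"
    using nonzero by (simp_all add: u_def f_def g_def)
  \<comment> \<open>The numerator of the sum is divisible by \<open>a + b\<close>, and the quotient
    is \<open>(a b)^2 P(z)\<close>.\<close>
  have q: "b^4 * g + a^4 * f = u * q"
    unfolding u_def f_def g_def q_def by algebra
  have "\<alpha> + \<beta> = 3 * k * (b^4 * g + a^4 * f) / (2 * a^3 * b^3 * u * f * g)"
    unfolding \<alpha>_def \<beta>_def add.commute[of b a] u_def[symmetric] f_def[symmetric] g_def[symmetric]
    using nz by (simp add: field_simps eval_nat_numeral)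
  also have "\<dots> = 3 * \<kappa> * poly P z / (2 * poly X z^3)"
    unfolding q \<kappa>_def poly_z f_def[symmetric] g_def[symmetric] q_def[symmetric]
    using nz by (simp add: field_simps eval_nat_numeral)
  finally show ?thesis .
qed

lemma det_eq: "\<alpha> * \<beta> - \<gamma> * \<delta> = \<kappa>^2 * poly Q z / (4 * poly X z^5 * poly V z^2)"
proof -
  define u where "u = a + b"
  define f where "f = 2 * b + 3 * a"
  define g where "g = 2 * a + 3 * b"
  have nz: "a \<noteq> 0" "b \<noteq> 0" "u \<noteq> 0" "f \<noteq> 0" "g \<noteq> 0"
    using nonzero by (simp_all add: u_def f_def g_def)
  show ?thesis
    unfolding \<alpha>_def \<beta>_def \<gamma>_def \<delta>_def \<kappa>_def poly_z add.commute[of b a]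
      u_def[symmetric] f_def[symmetric] g_def[symmetric]
    using nz by (simp add: field_simps eval_nat_numeral)
qed

text \<open>The first quantity is \<open>\<alpha> \<beta> - \<gamma> \<delta>\<close>, positive by
  \<open>det_eq\<close>. Multiplying by \<open>m\<close> turns the other two into
  \<open>trace_jury\<close> and \<open>\<kappa>\<close> times \<open>det_jury\<close>.\<close>

lemma jury:
  assumes det: "0 < det_jury z \<kappa>" and trace: "0 < trace_jury z \<kappa>"
  shows "0 < 1 - ((1 - \<alpha>) + (1 - \<beta>)) + ((1 - \<alpha>) * (1 - \<beta>) - \<gamma> * \<delta>)"
    and "0 < 1 + ((1 - \<alpha>) + (1 - \<beta>)) + ((1 - \<alpha>) * (1 - \<beta>) - \<gamma> * \<delta>)"
    and "0 < 1 - ((1 - \<alpha>) * (1 - \<beta>) - \<gamma> * \<delta>)"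
proof -
  note pos = poly_pos[OF z_nonneg] \<kappa>_pos
  define m where "m = 4 * poly X z^5 * poly V z^2"
  have m: "0 < m"
    using pos by (simp add: m_def)
  have "1 - ((1 - \<alpha>) + (1 - \<beta>)) + ((1 - \<alpha>) * (1 - \<beta>) - \<gamma> * \<delta>) = \<alpha> * \<beta> - \<gamma> * \<delta>"
    by (simp add: algebra_simps)
  also have "0 < \<dots>"
    unfolding det_eq using pos by simp
  finally show "0 < 1 - ((1 - \<alpha>) + (1 - \<beta>)) + ((1 - \<alpha>) * (1 - \<beta>) - \<gamma> * \<delta>)" .
  have sum: "m * (\<alpha> + \<beta>) = 6 * \<kappa> * poly P z * poly V z^2 * poly X z^2"
    unfolding trace_eq m_def using pos by (simp add: field_simps eval_nat_numeral)
  have det': "m * (\<alpha> * \<beta> - \<gamma> * \<delta>) = \<kappa>^2 * poly Q z"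
    unfolding det_eq m_def using pos by simp
  have "m * (1 + ((1 - \<alpha>) + (1 - \<beta>)) + ((1 - \<alpha>) * (1 - \<beta>) - \<gamma> * \<delta>)) =
      4 * m - 2 * (m * (\<alpha> + \<beta>)) + m * (\<alpha> * \<beta> - \<gamma> * \<delta>)"
    by (simp add: algebra_simps)
  also have "\<dots> = trace_jury z \<kappa>"
    unfolding sum det' unfolding m_def trace_jury_def by (simp add: algebra_simps)
  finally show "0 < 1 + ((1 - \<alpha>) + (1 - \<beta>)) + ((1 - \<alpha>) * (1 - \<beta>) - \<gamma> * \<delta>)"
    using m trace by (metis zero_less_mult_pos)
  have "m * (1 - ((1 - \<alpha>) * (1 - \<beta>) - \<gamma> * \<delta>)) =
      m * (\<alpha> + \<beta>) - m * (\<alpha> * \<beta> - \<gamma> * \<delta>)"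
    by (simp add: algebra_simps)
  also have "\<dots> = \<kappa> * det_jury z \<kappa>"
    unfolding sum det' det_jury_def by (simp add: algebra_simps power2_eq_square)
  finally show "0 < 1 - ((1 - \<alpha>) * (1 - \<beta>) - \<gamma> * \<delta>)"
    using m det \<kappa>_pos by (metis zero_less_mult_pos mult_pos_pos)
qed

text \<open>Otherwise the cofactor would be nonnegative, and the factorisation would give
  \<open>R4 \<le> 0\<close>.\<close>

lemma det_jury_pos: "0 < det_jury z \<kappa>" if "0 < R4 c1 c2 k"
proof (rule ccontr)
  assume "\<not> 0 < det_jury z \<kappa>"
  then have le: "det_jury z \<kappa> * R4_cofactor z \<kappa> \<le> 0"
    using R4_cofactor_nonneg[OF z_nonneg less_imp_le[OF \<kappa>_pos]] by (simp add: mult_nonpos_nonneg)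
  have "s^6 * (det_jury z \<kappa> * R4_cofactor z \<kappa>) \<le> 0"
    by (rule mult_nonneg_nonpos[OF _ le]) (use s_pos in simp)
  then show False
    using that unfolding k_eq R4_factor[OF c1_c2 diff_sq] by simp
qed

lemma trace_jury_pos: "0 < trace_jury z \<kappa>" if "0 < R3 c1 c2 k"
proof (rule ccontr)
  assume "\<not> 0 < trace_jury z \<kappa>"
  then have le: "trace_jury z \<kappa> * R3_cofactor z \<kappa> \<le> 0"
    using R3_cofactor_nonneg[OF z_nonneg less_imp_le[OF \<kappa>_pos]] by (simp add: mult_nonpos_nonneg)
  have "s^10 * (trace_jury z \<kappa> * R3_cofactor z \<kappa>) \<le> 0"
    by (rule mult_nonneg_nonpos[OF _ le]) (use s_pos in simp)
  then show False
    using that unfolding k_eq R3_factor[OF c1_c2 diff_sq] by simp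
qed

lemma trace_jury_pos_cases:
  assumes A: "0 < A1 c1 c2 k" "A2 c1 c2 k < 0" "0 < A3 c1 c2 k"
  shows "0 < trace_jury z \<kappa>"
proof (rule ccontr)
  assume "\<not> 0 < trace_jury z \<kappa>"
  then have lb: "4 * poly X z^3 \<le> 3 * poly P z * \<kappa>"
    using trace_jury_lower_bound[OF z_nonneg, of \<kappa>] by simp
  note pos = poly_pos[OF z_nonneg] \<kappa>_pos
  show False
  proof (cases "b \<le> a")
    case True
    \<comment> \<open>This weakens the bound \<open>4 X^3 / (3 P)\<close> on \<open>\<kappa>\<close>
      to \<open>16 X\<close>, which in the original variables is
      \<open>16 c1 c2 \<le> k\<close>.\<close>
    have "12 * poly P z \<le> poly X z^2"
      using z_nonneg by (simp add: X_def P_def algebra_simps power2_eq_square)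
    then have "poly P z * (48 * poly X z) \<le> poly X z^2 * (4 * poly X z)"
      using pos(1) by (simp add: mult_right_mono)
    also have "\<dots> = 4 * poly X z^3"
      by (simp add: eval_nat_numeral)
    also note lb
    finally have "16 * poly X z \<le> \<kappa>"
      using pos(2) by simp
    then have "16 * c1 * c2 \<le> k"
      using s_pos c1_c2 mult_left_mono[of "16 * poly X z" \<kappa> s] by (simp add: k_eq mult.assoc)
    moreover have "0 \<le> c1 - c2"
      unfolding diff using True a b by simp
    ultimately show False
      using A2_nonneg[OF c2 _ _ A(1)] A(2) by simp
  next
    case False
    define t where "t = b / a"
    \<comment> \<open>The scale for which the costs become \<open>m (3t + 2)\<close> and
      \<open>m t^3 (2t + 3)\<close>.\<close>
    define m where "m = a^2 / ((2 * t + 3) * (3 * t + 2))"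
    have t: "1 \<le> t" and bt: "b = t * a"
      using False a by (simp_all add: t_def)
    have nz: "a \<noteq> 0" "t \<noteq> 0" "2 * t + 3 \<noteq> 0" "3 * t + 2 \<noteq> 0"
      using t a by simp_all
    have fg: "2 * b + 3 * a = a * (2 * t + 3)" "2 * a + 3 * b = a * (3 * t + 2)"
      by (simp_all add: bt algebra_simps)
    define f where "f = 2 * t + 3"
    define g where "g = 3 * t + 2"
    have "m * (3 * t + 2) = c1" "m * (t^3 * (2 * t + 3)) = c2"
      unfolding costs fg using nz unfolding m_def bt f_def[symmetric] g_def[symmetric]
      by (simp_all add: field_simps eval_nat_numeral)
    moreover have m: "0 < m"
      using t a by (simp add: m_def)
    moreover have "4 * t^3 * ((2 * t + 3) * (3 * t + 2))^3
        \<le> 3 * (3 * t^4 - t^3 + t^2 - t + 3) * (k / m^2)"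
    proof -
      have X: "poly X z = f * g / t"
        unfolding poly_z fg using nz unfolding f_def[symmetric] g_def[symmetric] bt
        by (simp add: field_simps)
      have P: "t^2 * poly P z = 3 * t^4 - t^3 + t^2 - t + 3"
        unfolding poly_z bt using nz by (simp add: field_simps eval_nat_numeral)
      have \<kappa>: "t^4 * \<kappa> = k / m^2"
        unfolding \<kappa>_def X using nz unfolding m_def f_def[symmetric] g_def[symmetric] bt
        by (simp add: field_simps eval_nat_numeral)
      \<comment> \<open>The power \<open>t^6\<close> splits as \<open>t^2\<close> for
        \<open>P\<close> and \<open>t^4\<close> for \<open>\<kappa>\<close>, clearing both
        denominators.\<close>
      have "t^6 * (4 * poly X z^3) \<le> t^6 * (3 * poly P z * \<kappa>)"
        using lb t by (intro mult_left_mono) simp_all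
      also have "t^6 * (4 * poly X z^3) = 4 * t^3 * (f * g)^3"
        unfolding X using nz by (simp add: field_simps eval_nat_numeral)
      also have "t^6 * (3 * poly P z * \<kappa>) = 3 * (t^2 * poly P z) * (t^4 * \<kappa>)"
        by (simp add: eval_nat_numeral)
      finally show ?thesis
        unfolding P \<kappa> f_def g_def .
    qed
    moreover have "m^2 * (k / m^2) = k"
      using m by simp
    ultimately show False
      using A3_nonpos[of m t "k / m^2"] t A(3) by simp
  qed
qed

end

theorem theorem4:
  fixes c1 c2 k :: real
  assumes "c1 > 0" and "c2 > 0" and "k > 0" and "c1 \<noteq> c2"
  shows "(\<exists>!p. positive_equilibrium (G c1 c2 k k) p) \<and>
    (\<forall>p. positive_equilibrium (G c1 c2 k k) p \<longrightarrow>
      (R3 c1 c2 k > 0 \<and> R4 c1 c2 k > 0) \<or>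
      (R3 c1 c2 k < 0 \<and> R4 c1 c2 k > 0 \<and> A1 c1 c2 k > 0 \<and> A2 c1 c2 k < 0 \<and> A3 c1 c2 k > 0) \<longrightarrow>
      locally_stable (G c1 c2 k k) p)"
proof (intro conjI allI impI)
  show "\<exists>!p. positive_equilibrium (G c1 c2 k k) p"
    using assms by (intro ex1_positive_equilibrium)
next
  fix p
  assume "positive_equilibrium (G c1 c2 k k) p"
    and cond: "(R3 c1 c2 k > 0 \<and> R4 c1 c2 k > 0) \<or>
      (R3 c1 c2 k < 0 \<and> R4 c1 c2 k > 0 \<and> A1 c1 c2 k > 0 \<and> A2 c1 c2 k < 0 \<and> A3 c1 c2 k > 0)"
  then have p: "0 < p$1" "0 < p$2"
    and e: "sqrt (p$1)^3 = (2 * sqrt (p$2) + 3 * sqrt (p$1)) * c1"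
      "sqrt (p$2)^3 = (2 * sqrt (p$1) + 3 * sqrt (p$2)) * c2"
    using assms by (simp_all add: positive_equilibrium_iff)
  interpret equilibrium "sqrt (p$1)" "sqrt (p$2)" c1 c2 k
    "(sqrt (p$2) - sqrt (p$1))^2 / (sqrt (p$1) * sqrt (p$2))"
    "k * poly X ((sqrt (p$2) - sqrt (p$1))^2 / (sqrt (p$1) * sqrt (p$2)))^2
      / (sqrt (p$1) * sqrt (p$2))^2"
    using assms p e by unfold_locales simp_all
  \<comment> \<open>The second coordinate of \<open>G\<close> is the first with prices and costs
    exchanged, so one derivative lemma yields both rows.\<close>
  have d: "(G c1 c2 k k has_derivative
      (\<lambda>h. vector [(1 - \<alpha>) * h$1 + \<gamma> * h$2, \<delta> * h$1 + (1 - \<beta>) * h$2])) (at p)"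
    unfolding G_def add.commute[of "\<delta> * _"]
    using has_derivative_vector_2[OF has_derivative_price[OF p e(1), of k]
        has_derivative_price[OF p(2,1) e(2), of k]]
    by (simp add: \<alpha>_def \<beta>_def \<gamma>_def \<delta>_def mult.commute[of "_ $ 2" "_ $ 1"]
        add.commute[of "sqrt (_ $ 2)" "sqrt (_ $ 1)"] add.commute[of "_ * _ $ 2" "_ * _ $ 1"])
  show "locally_stable (G c1 c2 k k) p"
    using cond
    by (intro locally_stable_2[OF d] jury det_jury_pos) (auto intro: trace_jury_pos trace_jury_pos_cases)
qed

end
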